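(* Let $E,\hat B(0)\in\mathbb{H}\setminus\{0\}$ and $u(0)\in\mathbb{S}^2$ be such that $(\operatorname{Re}(\hat B(0)u(0)),\operatorname{Re}(\hat B(0)))\neq(0,0)$. Then the following steps can be iterated, starting from $i=0$: 1. Calculate $\hat B(i+1):=\hat B(i)+u(i)E-Eu(i)$. 2. Calculate $u(i+1):=\hat B(i+1)^{-1}u(i)\hat B(i+1)$. The curve $\gamma$ with edge variables $\gamma(i+1)-\gamma(i)=u(i)$ is a $2$-invariant curve. Conversely, any $2$-invariant curve can be obtained this way.
   Context: $\mathbb{H}$ denotes the quaternions, $\vec q=\operatorname{Im}(q)$, $\operatorname{Im}(\mathbb{H})\cong\mathbb{R}^3$, and $\mathbb{S}^2=\{p\in\mathbb{H}:p^2=-1\}$ is the set of imaginary unit quaternions. A discrete curve is a map $\gamma:\mathbb{Z}\to\operatorname{Im}(\mathbb{H})$ with edges $u(k)=\gamma(k+1)-\gamma(k)$; it is arc-length parametrized if $|u(k)|=1$ for all $k$ and regular if $\gamma(k-1)\neq\gamma(k+1)$ for all $k$. Curves produced by the algorithm are considered for indices $i\geq0$ (the extension to $i<0$ is analogous). A Bäcklund transformation of a curve with edges $u(k)\in\mathbb{S}^2$ is given by quaternions $v(k)\in\mathbb{H}\setminus\mathbb{S}^2$ and a curve with edges $\tilde u(k)\in\mathbb{S}^2$ such that $u(k)+v(k+1)=v(k)+\tilde u(k)$ and $v(k+1)u(k)=\tilde u(k)v(k)$ for all $k$. A regular arc-length parametrized curve $\gamma$ is $2$-invariant if there is a sequence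 of two Bäcklund transformations, with quaternions $v(k,0)$ and $v(k,1)$, such that the second transform $\tilde\gamma$, with edges $\tilde u$, is related to $\gamma$ by a Euclidean motion, acting on edges as a rotation $u=E\tilde uE^{-1}$ with some $E\in\mathbb{H}\setminus\{0\}$, and such that the matrix $$M(k)=\begin{pmatrix}E&0\\0&E\end{pmatrix}\begin{pmatrix}v(k,1)&1\\-1&v(k,1)\end{pmatrix}\begin{pmatrix}v(k,0)&1\\-1&v(k,0)\end{pmatrix}=\begin{pmatrix}A&B\\-B&A\end{pmatrix}$$ does not act as the identity on $\mathbb{S}^2$ via $u\mapsto(A-Bu)u(A-Bu)^{-1}$, i.e. $(\vec A,\vec B)\neq(0,0)$. *)

theory Defs
  imports "HOL-Analysis.Analysis"
begin

section \<open>Quaternions\<close>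

text \<open>\<open>Quat a b c d\<close> is the quaternion \<open>a + b i + c j + d k\<close>, with the conventions
  \<open>i j = k\<close>, \<open>j k = i\<close>, \<open>k i = j\<close>.\<close>

datatype quat = Quat (qRe: real) (qI: real) (qJ: real) (qK: real)

lemma quat_eq_iff: "p = q \<longleftrightarrow> qRe p = qRe q \<and> qI p = qI q \<and> qJ p = qJ q \<and> qK p = qK q"
  by (cases p; cases q) simp

instantiation quat :: ab_group_add
begin
definition "0 = Quat 0 0 0 0"
definition "p + q = Quat (qRe p + qRe q) (qI p + qI q) (qJ p + qJ q) (qK p + qK q)"
definition "p - q = Quat (qRe p - qRe q) (qI p - qI q) (qJ p - qJ q) (qK p - qK q)"
definition "- p = Quat (- qRe p) (- qI p) (- qJ p) (- qK p)"
instance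
  by standard
    (simp_all add: quat_eq_iff zero_quat_def plus_quat_def minus_quat_def uminus_quat_def)
end

lemma quat_zero_sel [simp]: "qRe 0 = 0" "qI 0 = 0" "qJ 0 = 0" "qK 0 = 0"
  by (simp_all add: zero_quat_def)

lemma quat_add_sel [simp]:
  "qRe (p + q) = qRe p + qRe q" "qI (p + q) = qI p + qI q"
  "qJ (p + q) = qJ p + qJ q" "qK (p + q) = qK p + qK q"
  by (simp_all add: plus_quat_def)

lemma quat_diff_sel [simp]:
  "qRe (p - q) = qRe p - qRe q" "qI (p - q) = qI p - qI q"
  "qJ (p - q) = qJ p - qJ q" "qK (p - q) = qK p - qK q"
  by (simp_all add: minus_quat_def)

lemma quat_uminus_sel [simp]:
  "qRe (- p) = - qRe p" "qI (- p) = - qI p" "qJ (- p) = - qJ p" "qK (- p) = - qK p"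
  by (simp_all add: uminus_quat_def)

instantiation quat :: real_vector
begin
definition "r *\<^sub>R q = Quat (r * qRe q) (r * qI q) (r * qJ q) (r * qK q)"
instance
  by standard (simp_all add: quat_eq_iff scaleR_quat_def algebra_simps)
end

lemma quat_scaleR_sel [simp]:
  "qRe (r *\<^sub>R q) = r * qRe q" "qI (r *\<^sub>R q) = r * qI q"
  "qJ (r *\<^sub>R q) = r * qJ q" "qK (r *\<^sub>R q) = r * qK q"
  by (simp_all add: scaleR_quat_def)

instantiation quat :: real_algebra_1
begin
definition "1 = Quat 1 0 0 0"
definition "p * q = Quat
  (qRe p * qRe q - qI p * qI q - qJ p * qJ q - qK p * qK q)
  (qRe p * qI q + qI p * qRe q + qJ p * qK q - qK p * qJ q)
  (qRe p * qJ q - qI p * qK q + qJ p * qRe q + qK p * qI q)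
  (qRe p * qK q + qI p * qJ q - qJ p * qI q + qK p * qRe q)"
instance
  by standard (simp_all add: quat_eq_iff one_quat_def times_quat_def algebra_simps)
end

lemma quat_one_sel [simp]: "qRe 1 = 1" "qI 1 = 0" "qJ 1 = 0" "qK 1 = 0"
  by (simp_all add: one_quat_def)

lemma quat_mult_sel [simp]:
  "qRe (p * q) = qRe p * qRe q - qI p * qI q - qJ p * qJ q - qK p * qK q"
  "qI (p * q) = qRe p * qI q + qI p * qRe q + qJ p * qK q - qK p * qJ q"
  "qJ (p * q) = qRe p * qJ q - qI p * qK q + qJ p * qRe q + qK p * qI q"
  "qK (p * q) = qRe p * qK q + qI p * qJ q - qJ p * qI q + qK p * qRe q"
  by (simp_all add: times_quat_def)

abbreviation qnorm2 :: "quat \<Rightarrow> real" where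
  "qnorm2 q \<equiv> (qRe q)\<^sup>2 + (qI q)\<^sup>2 + (qJ q)\<^sup>2 + (qK q)\<^sup>2"

lemma qnorm2_eq_0: "qnorm2 q = 0 \<longleftrightarrow> q = 0"
  by (auto simp: quat_eq_iff add_nonneg_eq_0_iff)

instantiation quat :: real_div_algebra
begin
definition "inverse q = inverse (qnorm2 q) *\<^sub>R Quat (qRe q) (- qI q) (- qJ q) (- qK q)"
definition "p div (q::quat) = p * inverse q"
instance
proof
  fix p q :: quat
  have "Quat (qRe p) (- qI p) (- qJ p) (- qK p) * p = qnorm2 p *\<^sub>R 1"
    "p * Quat (qRe p) (- qI p) (- qJ p) (- qK p) = qnorm2 p *\<^sub>R 1"
    by (simp_all add: quat_eq_iff power2_eq_square)
  moreover have "qnorm2 p \<noteq> 0" if "p \<noteq> 0"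
    using that qnorm2_eq_0 by blast
  ultimately show "p \<noteq> 0 \<Longrightarrow> inverse p * p = 1" "p \<noteq> 0 \<Longrightarrow> p * inverse p = 1"
    by (simp_all add: inverse_quat_def del: quat_scaleR_sel)
  show "p div q = p * inverse q" by (rule divide_quat_def)
  show "inverse (0::quat) = 0" by (simp add: quat_eq_iff inverse_quat_def)
qed
end

instantiation quat :: real_normed_div_algebra
begin
definition "norm q = sqrt (qnorm2 q)"
definition "sgn (q::quat) = q /\<^sub>R norm q"
definition "dist p (q::quat) = norm (p - q)"
definition [code del]:
  "(uniformity :: (quat \<times> quat) filter) = (INF e\<in>{0<..}. principal {(p, q). dist p q < e})"
definition [code del]:
  "open (U :: quat set) \<longleftrightarrow> (\<forall>p\<in>U. eventually (\<lambda>(p', q). p' = p \<longrightarrow> q \<in> U) uniformity)"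
instance
proof
  fix p q :: quat and r :: real and U :: "quat set"
  have norm_eq: "norm q = norm ((qRe q, qI q), (qJ q, qK q))" for q
    by (simp add: norm_quat_def norm_Pair)
  show "dist p q = norm (p - q)" by (rule dist_quat_def)
  show "sgn p = p /\<^sub>R norm p" by (rule sgn_quat_def)
  show "uniformity = (INF e\<in>{0<..}. principal {(p, q::quat). dist p q < e})"
    by (rule uniformity_quat_def)
  show "open U \<longleftrightarrow> (\<forall>p\<in>U. \<forall>\<^sub>F (p', q) in uniformity. p' = p \<longrightarrow> q \<in> U)"
    by (rule open_quat_def)
  show "norm p = 0 \<longleftrightarrow> p = 0" by (simp add: norm_quat_def qnorm2_eq_0)
  show "norm (p + q) \<le> norm p + norm q"
    using norm_triangle_ineq[of "((qRe p, qI p), (qJ p, qK p))" "((qRe q, qI q), (qJ q, qK q))"]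
    by (simp add: norm_eq)
  have "norm (r *\<^sub>R ((qRe p, qI p), (qJ p, qK p))) = \<bar>r\<bar> * norm ((qRe p, qI p), (qJ p, qK p))"
    by (rule norm_scaleR)
  then show "norm (r *\<^sub>R p) = \<bar>r\<bar> * norm p"
    by (simp add: norm_eq)
  have "qnorm2 (p * q) = qnorm2 p * qnorm2 q"
    by (simp add: power2_eq_square algebra_simps)
  then show "norm (p * q) = norm p * norm q"
    by (simp add: norm_quat_def real_sqrt_mult)
qed
end

definition vec_part :: "quat \<Rightarrow> quat" where
  "vec_part q = Quat 0 (qI q) (qJ q) (qK q)"

definition imaginary :: "quat set" where
  "imaginary = {q. qRe q = 0}"

definition S2 :: "quat set" where
  "S2 = {p. p\<^sup>2 = - 1}"

section \<open>Discrete curves\<close>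

text \<open>All notions carry the set \<open>I\<close> of vertex indices. It is either \<open>UNIV\<close>, giving curves
  \<open>\<gamma> : \<int> \<rightarrow> Im \<bbbH>\<close>, or \<open>{0..}\<close>, giving the part of a curve with nonnegative indices. Both
  sets are closed under \<open>k \<mapsto> k + 1\<close>, so \<open>I\<close> is also the set of edge indices; values outside
  \<open>I\<close> are irrelevant.\<close>

definition discrete_curve :: "int set \<Rightarrow> (int \<Rightarrow> quat) \<Rightarrow> bool" where
  "discrete_curve I \<gamma> \<longleftrightarrow> (\<forall>k\<in>I. \<gamma> k \<in> imaginary)"

definition edge :: "(int \<Rightarrow> quat) \<Rightarrow> int \<Rightarrow> quat" where
  "edge \<gamma> k = \<gamma> (k + 1) - \<gamma> k"

definition arc_length_parametrized :: "int set \<Rightarrow> (int \<Rightarrow> quat) \<Rightarrow> bool" where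
  "arc_length_parametrized I \<gamma> \<longleftrightarrow> (\<forall>k\<in>I. norm (edge \<gamma> k) = 1)"

definition regular :: "int set \<Rightarrow> (int \<Rightarrow> quat) \<Rightarrow> bool" where
  "regular I \<gamma> \<longleftrightarrow> (\<forall>k. k - 1 \<in> I \<and> k + 1 \<in> I \<longrightarrow> \<gamma> (k - 1) \<noteq> \<gamma> (k + 1))"

definition baecklund_transform ::
  "int set \<Rightarrow> (int \<Rightarrow> quat) \<Rightarrow> (int \<Rightarrow> quat) \<Rightarrow> (int \<Rightarrow> quat) \<Rightarrow> bool" where
  "baecklund_transform I \<gamma> v \<gamma>' \<longleftrightarrow>
     discrete_curve I \<gamma> \<and> discrete_curve I \<gamma>' \<and>
     (\<forall>k\<in>I. edge \<gamma> k \<in> S2 \<and> edge \<gamma>' k \<in> S2 \<and> v k \<notin> S2 \<and>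
        edge \<gamma> k + v (k + 1) = v k + edge \<gamma>' k \<and>
        v (k + 1) * edge \<gamma> k = edge \<gamma>' k * v k)"

section \<open>Two-invariant curves\<close>

definition baecklund_matrix :: "quat \<Rightarrow> quat^2^2" where
  "baecklund_matrix v = vector [vector [v, 1], vector [- 1, v]]"

definition monodromy :: "quat \<Rightarrow> quat \<Rightarrow> quat \<Rightarrow> quat^2^2" where
  "monodromy E v0 v1 =
     vector [vector [E, 0], vector [0, E]] ** baecklund_matrix v1 ** baecklund_matrix v0"

text \<open>A matrix with rows \<open>(A, B)\<close> and \<open>(- B, A)\<close> acts on \<open>S2\<close> by
  \<open>u \<mapsto> (A - B u) u (A - B u)\<^sup>-\<^sup>1\<close>. For monodromy matrices, \<open>A - B u\<close> is
  invertible for every \<open>u\<close> in \<open>S2\<close>, see \<open>monodromy_denominator_nonzero\<close> below.\<close>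

definition S2_action :: "quat^2^2 \<Rightarrow> quat \<Rightarrow> quat" where
  "S2_action M u = (let A = M $ 1 $ 1; B = M $ 1 $ 2
     in (A - B * u) * u * inverse (A - B * u))"

definition acts_as_identity :: "quat^2^2 \<Rightarrow> bool" where
  "acts_as_identity M \<longleftrightarrow> (\<forall>u\<in>S2. S2_action M u = u)"

text \<open>The orientation preserving Euclidean motions of \<open>Im \<bbbH>\<close> are the maps
  \<open>x \<mapsto> E x E\<^sup>-\<^sup>1 + c\<close>; they act on edges as \<open>u \<mapsto> E u E\<^sup>-\<^sup>1\<close>.\<close>

definition two_invariant :: "int set \<Rightarrow> (int \<Rightarrow> quat) \<Rightarrow> bool" where
  "two_invariant I \<gamma> \<longleftrightarrow>
     discrete_curve I \<gamma> \<and> arc_length_parametrized I \<gamma> \<and> regular I \<gamma> \<and>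
     (\<exists>v0 v1 \<gamma>1 \<gamma>2 E c.
        baecklund_transform I \<gamma> v0 \<gamma>1 \<and> baecklund_transform I \<gamma>1 v1 \<gamma>2 \<and>
        E \<noteq> 0 \<and> c \<in> imaginary \<and> (\<forall>k\<in>I. \<gamma> k = E * \<gamma>2 k * inverse E + c) \<and>
        (\<forall>k\<in>I. \<not> acts_as_identity (monodromy E (v0 k) (v1 k))))"

section \<open>The algorithm\<close>

definition admissible_data :: "quat \<Rightarrow> quat \<Rightarrow> quat \<Rightarrow> bool" where
  "admissible_data E B0 u0 \<longleftrightarrow>
     E \<noteq> 0 \<and> B0 \<noteq> 0 \<and> u0 \<in> S2 \<and> (qRe (B0 * u0), qRe B0) \<noteq> (0, 0)"

text \<open>Every iteration must be executable, that is, \<open>B (i + 1)\<close> must be invertible. On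
  \<open>I = UNIV\<close> the same two relations, solved backwards as \<open>u i = B (i+1) u (i+1) B (i+1)\<^sup>-\<^sup>1\<close> and
  \<open>B i = B (i+1) - u i E + E u i\<close>, determine the extension to negative indices.\<close>

definition algorithm_run ::
  "int set \<Rightarrow> quat \<Rightarrow> quat \<Rightarrow> quat \<Rightarrow> (int \<Rightarrow> quat) \<Rightarrow> (int \<Rightarrow> quat) \<Rightarrow> bool" where
  "algorithm_run I E B0 u0 B u \<longleftrightarrow>
     B 0 = B0 \<and> u 0 = u0 \<and>
     (\<forall>i\<in>I. B (i + 1) = B i + u i * E - E * u i \<and>
             B (i + 1) \<noteq> 0 \<and>
             u (i + 1) = inverse (B (i + 1)) * u i * B (i + 1))"

section \<open>The action of the monodromy on the sphere\<close>

lemma monodromy_entries: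
  "monodromy E v0 v1 $ 1 $ 1 = E * (v1 * v0 - 1)" "monodromy E v0 v1 $ 1 $ 2 = E * (v1 + v0)"
  "monodromy E v0 v1 $ 2 $ 1 = - (E * (v1 + v0))" "monodromy E v0 v1 $ 2 $ 2 = E * (v1 * v0 - 1)"
  by (simp_all add: monodromy_def baecklund_matrix_def matrix_matrix_mult_def sum_2 algebra_simps)

lemma monodromy_denominator_nonzero:
  assumes "E \<noteq> 0" "v0 \<notin> S2" "v1 \<notin> S2" "u \<in> S2"
  shows "monodromy E v0 v1 $ 1 $ 1 - monodromy E v0 v1 $ 1 $ 2 * u \<noteq> 0"
proof
  assume "monodromy E v0 v1 $ 1 $ 1 - monodromy E v0 v1 $ 1 $ 2 * u = 0"
  then have "E * (v1 * v0 - 1 - (v1 + v0) * u) = 0"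
    by (simp add: monodromy_entries right_diff_distrib mult.assoc)
  then have eq: "v1 * (v0 - u) = 1 + v0 * u"
    using assms(1) by (simp only: mult_eq_0_iff) (simp add: algebra_simps)
  have uu: "u * u = - 1" using assms(4) by (simp add: S2_def power2_eq_square)
  have "(v0 - u) * u = 1 + v0 * u" using uu by (simp add: algebra_simps)
  moreover have "v0 \<noteq> u" using assms by blast
  ultimately have "v1 = (v0 - u) * u * inverse (v0 - u)"
    using eq by (metis eq_iff_diff_eq_0 mult.assoc mult.right_neutral right_inverse)
  then have "v1 * v1 = (v0 - u) * u * (inverse (v0 - u) * (v0 - u)) * u * inverse (v0 - u)"
    by (simp only: mult.assoc)
  also have "\<dots> = (v0 - u) * (u * u) * inverse (v0 - u)"
    using \<open>v0 \<noteq> u\<close> by (simp add: mult.assoc)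
  also have "\<dots> = - ((v0 - u) * inverse (v0 - u))"
    by (simp only: uu mult_minus_right mult_minus_left mult_1_right)
  also have "\<dots> = - 1" using \<open>v0 \<noteq> u\<close> by simp
  finally show False using assms(3) by (simp add: S2_def power2_eq_square)
qed

lemma acts_as_identity_iff:
  assumes "\<And>u. u \<in> S2 \<Longrightarrow> M $ 1 $ 1 - M $ 1 $ 2 * u \<noteq> 0"
  shows "acts_as_identity M \<longleftrightarrow> vec_part (M $ 1 $ 1) = 0 \<and> vec_part (M $ 1 $ 2) = 0"
proof -
  define A B where "A = M $ 1 $ 1" and "B = M $ 1 $ 2"
  have fixed: "S2_action M u = u \<longleftrightarrow> (A - B * u) * u = u * (A - B * u)" if "u \<in> S2" for u
  proof -
    have nz: "A - B * u \<noteq> 0" using assms[OF that] by (simp add: A_def B_def)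
    have "x * inverse w = u \<longleftrightarrow> x = u * w" if "w \<noteq> 0" for x w
      using that by (metis mult.assoc mult.right_neutral left_inverse right_inverse)
    from this[OF nz] show ?thesis by (simp add: S2_action_def A_def B_def Let_def)
  qed
  have units: "Quat 0 1 0 0 \<in> S2" "Quat 0 0 1 0 \<in> S2" "Quat 0 0 0 1 \<in> S2"
    by (simp_all add: S2_def power2_eq_square quat_eq_iff)
  show ?thesis
  proof
    assume "acts_as_identity M"
    then have "(A - B * u) * u = u * (A - B * u)" if "u \<in> S2" for u
      using that fixed by (simp add: acts_as_identity_def)
    from this[OF units(1)] this[OF units(2)] this[OF units(3)]
    show "vec_part (M $ 1 $ 1) = 0 \<and> vec_part (M $ 1 $ 2) = 0"
      unfolding A_def[symmetric] B_def[symmetric]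
      by (auto simp: vec_part_def quat_eq_iff)
  next
    assume "vec_part (M $ 1 $ 1) = 0 \<and> vec_part (M $ 1 $ 2) = 0"
    then have "(A - B * u) * u = u * (A - B * u)" for u
      unfolding A_def[symmetric] B_def[symmetric]
      by (simp add: vec_part_def quat_eq_iff algebra_simps)
    then show "acts_as_identity M"
      using fixed by (simp add: acts_as_identity_def)
  qed
qed

end

theory Submission
  imports Defs "HOL-Computational_Algebra.Fundamental_Theorem_Algebra"
begin

text \<open>With \<open>J = ((0, 1), (- 1, 0))\<close> in the role of a central variable \<open>\<lambda>\<close>, the monodromy is the
  polynomial \<open>P = E (v1 + \<lambda>) (v0 + \<lambda>) = E \<lambda>\<^sup>2 + B \<lambda> + C\<close>, where \<open>A = C - E\<close>, and the Baecklund
  equations say that \<open>P(k+1) (u(k) + \<lambda>) = (u(k) + \<lambda>) P(k)\<close>. The \<open>\<lambda>\<^sup>2\<close> coefficient of this is step 1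
  of the algorithm.

  From a run of the algorithm one obtains such polynomials as
  \<open>E \<lambda>\<^sup>2 + B(k) \<lambda> + (E + t + B(k) u(k))\<close> with \<open>t\<close> real. One root of the polynomial at \<open>k = 0\<close> splits
  it into linear factors, and the Baecklund evolution of this root splits all the others.

  Conversely, the monodromy at \<open>k + 1\<close> fixes both \<open>- u(k)\<close> and \<open>u(k+1)\<close>, which are distinct by
  regularity. A nontrivial map with two distinct fixed points \<open>x, y\<close> satisfies
  \<open>(Im B - Re(A y)) y = - x (Im B - Re(A y))\<close>, and \<open>Re(A(k) u(k))\<close> does not depend on \<open>k\<close>, so that
  \<open>Im B(k) - Re(A(k) u(k))\<close> is the sequence of the algorithm.\<close>

section \<open>Quaternions\<close>

lemma S2_iff_mult: "p \<in> S2 \<longleftrightarrow> p * p = - 1"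
  by (simp add: S2_def power2_eq_square)

lemma S2_iff: "p \<in> S2 \<longleftrightarrow> qRe p = 0 \<and> (qI p)\<^sup>2 + (qJ p)\<^sup>2 + (qK p)\<^sup>2 = 1"
proof
  assume "p \<in> S2"
  then have eq: "qRe p * qRe p - qI p * qI p - qJ p * qJ p - qK p * qK p = - 1"
      "qRe p * qI p = 0" "qRe p * qJ p = 0" "qRe p * qK p = 0"
    by (auto simp: S2_iff_mult quat_eq_iff)
  have "qRe p = 0"
  proof (rule ccontr)
    assume "qRe p \<noteq> 0"
    with eq have "qRe p * qRe p = - 1" by simp
    then show False using zero_le_square[of "qRe p"] by linarith
  qed
  with eq(1) show "qRe p = 0 \<and> (qI p)\<^sup>2 + (qJ p)\<^sup>2 + (qK p)\<^sup>2 = 1"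
    by (simp add: power2_eq_square)
qed (simp add: S2_iff_mult quat_eq_iff power2_eq_square)

lemma norm_S2: "norm p = 1" if "p \<in> S2"
  using that by (simp add: norm_quat_def S2_iff)

lemma qRe_mult_commute: "qRe (p * q) = qRe (q * p)"
  by simp

text \<open>\<open>p\<close> and \<open>q\<close> are conjugate by \<open>h\<close>. The relation
  carries no inverse because the Baecklund equations and the algorithm are used in this
  form.\<close>

lemma quat_conj_invariants:
  assumes "h \<noteq> 0" "p * h = h * q"
  shows "p \<in> S2 \<longleftrightarrow> q \<in> S2" "qRe p = qRe q"
proof -
  have p: "p = h * q * inverse h"
    using assms by (metis mult.assoc mult.right_neutral right_inverse)
  have "p * p = - 1 \<longleftrightarrow> (p * p) * h = - h"
    using assms(1) by (metis mult_cancel_right mult_minus1)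
  also have "(p * p) * h = h * (q * q)"
    using assms(2) by (metis mult.assoc)
  also have "h * (q * q) = - h \<longleftrightarrow> q * q = - 1"
    using assms(1) by (metis mult_cancel_left mult_minus1_right)
  finally show "p \<in> S2 \<longleftrightarrow> q \<in> S2" by (simp add: S2_iff_mult)
  have "qRe p = qRe (inverse h * (h * q))"
    unfolding p by (rule qRe_mult_commute)
  also have "inverse h * (h * q) = q"
    using assms(1) by (simp flip: mult.assoc)
  finally show "qRe p = qRe q" .
qed

text \<open>Cayley-Hamilton for quaternions.\<close>

lemma quat_square: "q * q = (2 * qRe q) *\<^sub>R q - qnorm2 q *\<^sub>R 1"
  by (simp add: quat_eq_iff power2_eq_square)

section \<open>Sequences on index sets\<close>

text \<open>The equivalence in the step serves the upward induction and, on \<open>UNIV\<close>,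
  also the downward one.\<close>

lemma index_induct:
  fixes I :: "int set"
  assumes "I = {0..} \<or> I = UNIV" "k \<in> I" "P 0" "\<And>i. i \<in> I \<Longrightarrow> P i \<longleftrightarrow> P (i + 1)"
  shows "P k"
proof (cases "0 \<le> k")
  case True
  then show ?thesis
    by (induction k rule: int_ge_induct) (use assms in auto)
next
  case False
  then have I: "I = UNIV" and "k \<le> 0" using assms by auto
  from \<open>k \<le> 0\<close> show ?thesis
  proof (induction k rule: int_le_induct)
    case (step i)
    then show ?case using assms(4)[of "i - 1"] I by simp
  qed (rule assms(3))
qed

text \<open>Both half-lines are built by dependent choice inside the invariant set \<open>S\<close>
  and glued at \<open>0\<close>.\<close>

lemma two_sided_recursion:
  fixes R :: "int \<Rightarrow> 'a \<Rightarrow> 'a \<Rightarrow> bool"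
  assumes "x0 \<in> S"
    and fwd: "\<And>i x. x \<in> S \<Longrightarrow> \<exists>y\<in>S. R i x y"
    and bwd: "\<And>i y. y \<in> S \<Longrightarrow> \<exists>x\<in>S. R i x y"
  obtains f where "f 0 = x0" "\<And>i. f i \<in> S" "\<And>i. R i (f i) (f (i + 1))"
proof -
  have "\<exists>g. \<forall>n. (g n \<in> S \<and> (n = 0 \<longrightarrow> g n = x0)) \<and> R (int n) (g n) (g (Suc n))"
    by (rule dependent_nat_choice) (use assms(1) fwd in auto)
  then obtain g where "\<forall>n. (g n \<in> S \<and> (n = 0 \<longrightarrow> g n = x0)) \<and> R (int n) (g n) (g (Suc n))" ..
  then have g: "\<And>n. g n \<in> S" "g 0 = x0" "\<And>n. R (int n) (g n) (g (Suc n))"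
    by auto
  \<comment> \<open>The \<open>n\<close>-th value sits at index \<open>- n\<close>, so the relation
    between the values \<open>Suc n\<close> and \<open>n\<close> carries the lower index
    \<open>- n - 1\<close>.\<close>
  have "\<exists>g. \<forall>n. (g n \<in> S \<and> (n = 0 \<longrightarrow> g n = x0)) \<and> R (- int n - 1) (g (Suc n)) (g n)"
    by (rule dependent_nat_choice) (use assms(1) bwd in auto)
  then obtain h where "\<forall>n. (h n \<in> S \<and> (n = 0 \<longrightarrow> h n = x0)) \<and> R (- int n - 1) (h (Suc n)) (h n)" ..
  then have h: "\<And>n. h n \<in> S" "h 0 = x0" "\<And>n. R (- int n - 1) (h (Suc n)) (h n)"
    by auto
  define f where "f i = (if 0 \<le> i then g (nat i) else h (nat (- i)))" for i
  show thesis
  proof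
    show "f 0 = x0" "f i \<in> S" for i using g h by (simp_all add: f_def)
    show "R i (f i) (f (i + 1))" for i
    proof (cases "0 \<le> i")
      case True
      then have "nat (i + 1) = Suc (nat i)" by linarith
      then show ?thesis using True g(3)[of "nat i"] by (simp add: f_def)
    next
      case False
      define n where "n = nat (- i - 1)"
      have i: "i = - int n - 1" using False by (simp add: n_def)
      have "f i = h (Suc n)" by (simp add: f_def i nat_add_distrib)
      moreover have "f (i + 1) = h n" using g h by (cases n) (simp_all add: f_def i nat_add_distrib)
      ultimately show ?thesis using h(3)[of n] by (simp add: i)
    qed
  qed
qed

section \<open>Baecklund transformations of edges\<close>

text \<open>Eliminating the new edge \<open>u + v' - v\<close> from the two Baecklund equations
  leaves the third hypothesis. Both the new edge and \<open>v'\<close> are thus conjugates by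
  \<open>u - v\<close>, which is nonzero because \<open>u\<close> lies in \<open>S2\<close> and
  \<open>v\<close> does not.\<close>

lemma baecklund_edge:
  assumes "u \<in> S2" "v \<notin> S2" "v' * (u - v) = (u - v) * v"
  shows "u + v' - v \<in> S2" "v' * u = (u + v' - v) * v" "v' \<notin> S2" "qRe v' = qRe v"
proof -
  have "u - v \<noteq> 0" using assms by auto
  have "(u + v' - v) * (u - v) = (u - v) * u"
    using assms(3) by (simp add: algebra_simps)
  from quat_conj_invariants[OF \<open>u - v \<noteq> 0\<close> this] show "u + v' - v \<in> S2" using assms by simp
  show "v' * u = (u + v' - v) * v" using assms(3) by (simp add: algebra_simps)
  show "v' \<notin> S2" "qRe v' = qRe v"
    using quat_conj_invariants[OF \<open>u - v \<noteq> 0\<close> assms(3)] assms(2) by simp_all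
qed

lemma baecklund_edge_forward:
  assumes "u \<in> S2" "v \<notin> S2"
  shows "\<exists>v'. v' \<notin> S2 \<and> v' * (u - v) = (u - v) * v"
proof -
  have "u - v \<noteq> 0" using assms by auto
  then have "(u - v) * v * inverse (u - v) * (u - v) = (u - v) * v"
    by (simp add: mult.assoc)
  with baecklund_edge(3)[OF assms this] show ?thesis by blast
qed

text \<open>The denominator \<open>h\<close> is \<open>u\<close> minus the conjugate of \<open>v'\<close>.\<close>

lemma baecklund_edge_backward:
  assumes "u \<in> S2" "v' \<notin> S2"
  shows "\<exists>v. v \<notin> S2 \<and> v' * (u - v) = (u - v) * v"
proof -
  define h where "h = u - (2 * qRe v') *\<^sub>R 1 + v'"
  have "h \<noteq> 0"
  proof
    assume "h = 0"
    then have "qRe v' = qRe u" "qI v' = - qI u" "qJ v' = - qJ u" "qK v' = - qK u"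
      by (simp_all add: h_def quat_eq_iff)
    then show False using assms by (simp add: S2_iff)
  qed
  define v where "v = inverse h * v' * h"
  have hv: "v' * h = h * v"
    using \<open>h \<noteq> 0\<close> by (simp add: v_def flip: mult.assoc)
  note inv = quat_conj_invariants[OF \<open>h \<noteq> 0\<close> hv]
  have "norm v = norm v'"
    using \<open>h \<noteq> 0\<close> by (simp add: v_def norm_mult norm_inverse)
  then have "qnorm2 v = qnorm2 v'" by (simp add: norm_quat_def)
  \<comment> \<open>\<open>v\<close> and \<open>v'\<close> share real part and norm, hence satisfy
    the same real quadratic, which removes their squares.\<close>
  then have "v * v = (2 * qRe v') *\<^sub>R v - qnorm2 v' *\<^sub>R 1"
    using quat_square[of v] inv(2) by simp
  moreover have "v' * u - qnorm2 v' *\<^sub>R 1 = u * v - (2 * qRe v') *\<^sub>R v + v' * v"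
    using hv quat_square[of v'] by (simp add: h_def algebra_simps)
  ultimately have "v' * (u - v) = (u - v) * v"
    by (simp add: right_diff_distrib left_diff_distrib) (simp add: algebra_simps)
  then show ?thesis using inv(1) assms(2) by blast
qed

section \<open>Quadratic quaternionic polynomials\<close>

text \<open>A root \<open>z\<close> of the norm polynomial of \<open>E \<lambda>\<^sup>2 + B \<lambda> + C\<close> (\<open>\<lambda>\<close> central, with right root \<open>\<lambda> = - v\<close>) determines
  the real trace and norm of a quaternionic root, up to the sign of \<open>z\<close>; reducing modulo the
  corresponding real quadratic leaves a linear equation \<open>R v = S\<close>.\<close>

lemma quat_quadratic_root:
  fixes E B C :: quat
  assumes "E \<noteq> 0"
  obtains v where "E * v * v - B * v + C = 0"
proof -
  define dot :: "quat \<Rightarrow> quat \<Rightarrow> real" where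
    "dot p q = qRe p * qRe q + qI p * qI q + qJ p * qJ q + qK p * qK q" for p q
  have dot_pos: "dot p p = 0 \<longleftrightarrow> p = 0" for p
    using qnorm2_eq_0[of p] by (simp add: dot_def power2_eq_square)
  \<comment> \<open>The squared norm of \<open>E x^2 + B x + C\<close> for real \<open>x\<close>,
    read as a complex polynomial.\<close>
  define N where "N = map_poly complex_of_real
    [:dot C C, 2 * dot B C, dot B B + 2 * dot E C, 2 * dot E B, dot E E:]"
  have "dot E E \<noteq> 0" using assms dot_pos by simp
  then have "degree N = 4"
    by (simp add: N_def degree_map_poly)
  then have "\<not> constant (poly N)" using constant_degree[of N] by simp
  from fundamental_theorem_of_algebra[OF this] obtain z where z: "poly N z = 0" ..
  define x y where "x = Re z" and "y = Im z"
  define R S where "R = (2 * x) *\<^sub>R E + B" and "S = C - (x\<^sup>2 + y\<^sup>2) *\<^sub>R E"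
  \<comment> \<open>\<open>P\<close> and \<open>y * Q\<close> are the real and imaginary parts of
    \<open>poly N z\<close>.\<close>
  define P where "P = dot C C + 2 * dot B C * x + (dot B B + 2 * dot E C) * (x\<^sup>2 - y\<^sup>2)
    + 2 * dot E B * (x ^ 3 - 3 * x * y\<^sup>2) + dot E E * (x ^ 4 - 6 * x\<^sup>2 * y\<^sup>2 + y ^ 4)"
  define Q where "Q = 2 * dot B C + (dot B B + 2 * dot E C) * (2 * x)
    + 2 * dot E B * (3 * x\<^sup>2 - y\<^sup>2) + dot E E * (4 * x ^ 3 - 4 * x * y\<^sup>2)"
  have "poly N z = Complex P (y * Q)"
    by (simp add: N_def P_def Q_def complex_eq_iff x_def y_def map_poly_pCons)
      (simp add: algebra_simps power2_eq_square power3_eq_cube power4_eq_xxxx)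
  with z have PQ: "P = 0" "y = 0 \<or> Q = 0" by (auto simp: complex_eq_iff)
  show thesis
  proof (cases "y = 0")
    case True
    have "P = dot (x\<^sup>2 *\<^sub>R E + x *\<^sub>R B + C) (x\<^sup>2 *\<^sub>R E + x *\<^sub>R B + C)"
      using True by (simp add: P_def dot_def)
        (simp add: algebra_simps power2_eq_square power3_eq_cube power4_eq_xxxx)
    then have "x\<^sup>2 *\<^sub>R E + x *\<^sub>R B + C = 0" using PQ dot_pos by simp
    then show thesis
      using that[of "- (x *\<^sub>R 1)"] by (simp add: power2_eq_square)
  next
    case False
    \<comment> \<open>\<open>Q0\<close> and \<open>P0\<close> say that \<open>inverse R * S\<close>,
      if \<open>R\<close> is nonzero, has real part \<open>- x\<close> and squared norm
      \<open>x^2 + y^2\<close>.\<close>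
    have Q0: "2 * dot R S + 2 * x * dot R R = 0"
    proof -
      have "2 * dot R S + 2 * x * dot R R = Q"
        by (simp add: Q_def R_def S_def dot_def)
          (simp add: algebra_simps power2_eq_square power3_eq_cube)
      with False PQ show ?thesis by simp
    qed
    have "dot R R * (x\<^sup>2 - y\<^sup>2) + 2 * dot R S * x + dot S S = P"
      by (simp add: P_def R_def S_def dot_def)
        (simp add: algebra_simps power2_eq_square power3_eq_cube power4_eq_xxxx)
    moreover have "2 * dot R S * x = - (2 * x\<^sup>2 * dot R R)"
    proof -
      have "2 * dot R S = - (2 * x * dot R R)" using Q0 by linarith
      then show ?thesis by (simp add: power2_eq_square)
    qed
    ultimately have P0: "dot S S = (x\<^sup>2 + y\<^sup>2) * dot R R"
      using PQ(1) by (simp add: algebra_simps)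
    have root: "E * v * v - B * v + C = 0"
      if v: "qRe v = - x" "qnorm2 v = x\<^sup>2 + y\<^sup>2" "R * v = S" for v
    proof -
      have "E * v * v - B * v + C = E * (v * v) - B * v + C" by (simp add: mult.assoc)
      also have "\<dots> = S - R * v"
        unfolding quat_square[of v] v(2) unfolding v(1) by (simp add: R_def S_def algebra_simps)
      finally show "E * v * v - B * v + C = 0" by (simp add: v(3))
    qed
    show thesis
    proof (cases "R = 0")
      case True
      then have "S = 0" using P0 dot_pos by (simp add: dot_def)
      \<comment> \<open>The linear equation is void, so any quaternion with the prescribed real part
        and norm is a root.\<close>
      with True show thesis by (intro that[OF root[of "Quat (- x) y 0 0"]]) simp_all
    next
      case False
      then have RR: "dot R R \<noteq> 0" using dot_pos by simp
      have inv: "inverse R = inverse (dot R R) *\<^sub>R Quat (qRe R) (- qI R) (- qJ R) (- qK R)"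
        by (simp add: inverse_quat_def dot_def power2_eq_square)
      show thesis
      proof (rule that[OF root])
        show "R * (inverse R * S) = S" using False by (simp flip: mult.assoc)
        have "qRe (inverse R * S) = inverse (dot R R) * dot R S"
          unfolding inv by (simp add: dot_def algebra_simps)
        also have "\<dots> = - x" using Q0 RR by (simp add: field_simps)
        finally show "qRe (inverse R * S) = - x" .
        have qn: "qnorm2 q = (norm q)\<^sup>2" "qnorm2 q = dot q q" for q
          by (simp_all add: norm_quat_def dot_def power2_eq_square)
        have "qnorm2 (inverse R * S) = inverse (qnorm2 R) * qnorm2 S"
          unfolding qn(1) by (simp add: norm_mult norm_inverse power_mult_distrib power_inverse)
        then show "qnorm2 (inverse R * S) = x\<^sup>2 + y\<^sup>2"
          unfolding qn(2) using P0 RR by simp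
      qed
    qed
  qed
qed
section \<open>Conjugation of quadratic polynomials by an edge\<close>

text \<open>The hypotheses on \<open>E, B, C, B', C', u\<close> below are the coefficients of
  \<open>(E \<lambda>\<^sup>2 + B' \<lambda> + C') (u + \<lambda>) = (u + \<lambda>) (E \<lambda>\<^sup>2 + B \<lambda> + C)\<close>.\<close>

definition conjugate_step :: "quat \<Rightarrow> quat \<Rightarrow> quat \<Rightarrow> quat \<Rightarrow> quat \<Rightarrow> quat \<Rightarrow> bool" where
  "conjugate_step E u B C B' C' \<longleftrightarrow>
     B' + E * u = u * E + B \<and> C' + B' * u = C + u * B \<and> C' * u = u * C"

text \<open>Right evaluation of the polynomial identity at \<open>- v\<close> gives
  \<open>?q' * (u - v) = u * ?q - ?q * v\<close>. If \<open>?q'\<close> is zero and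
  \<open>?q\<close> is not, then \<open>v\<close> is conjugate to \<open>u\<close>, hence in
  \<open>S2\<close>.\<close>

lemma root_step_iff:
  assumes "u \<in> S2" "v \<notin> S2" "v' * (u - v) = (u - v) * v" "conjugate_step E u B C B' C'"
  shows "E * v * v - B * v + C = 0 \<longleftrightarrow> E * v' * v' - B' * v' + C' = 0"
    (is "?q = 0 \<longleftrightarrow> ?q' = 0")
proof -
  note cs = assms(4)[unfolded conjugate_step_def]
  have "u - v \<noteq> 0" using assms by auto
  have "v' * (v' * (u - v)) = (u - v) * (v * v)"
    using assms(3) by (metis mult.assoc)
  then have "?q' * (u - v) = E * ((u - v) * (v * v)) - B' * ((u - v) * v) + C' * (u - v)"
    using assms(3) by (simp only: left_diff_distrib distrib_right mult.assoc)
  also have "\<dots> = (B' + E * u) * (v * v) - E * v * v * v - (C' + B' * u) * v + C' * u"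
    by (simp add: algebra_simps)
  also have "\<dots> = u * ?q - ?q * v"
    using cs by (simp add: algebra_simps)
  finally have eq: "?q' * (u - v) = u * ?q - ?q * v" .
  show ?thesis
  proof
    assume "?q = 0"
    then have "?q' * (u - v) = 0" using eq by simp
    then show "?q' = 0" using \<open>u - v \<noteq> 0\<close> by simp
  next
    assume "?q' = 0"
    then have "u * ?q = ?q * v" using eq by simp
    then show "?q = 0" using quat_conj_invariants(1)[of ?q u v] assms(1,2) by blast
  qed
qed

text \<open>The root \<open>v\<close> splits the polynomial as
  \<open>E (w + \<lambda>) (v + \<lambda>)\<close>. Moving the edge factor past
  \<open>v + \<lambda>\<close> turns \<open>u\<close> into \<open>u + v' - v\<close>; moving it past
  \<open>w + \<lambda>\<close> must then give \<open>inverse E * u * E\<close>, which is a second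
  Baecklund transformation.\<close>

lemma second_factor_step:
  assumes "E \<noteq> 0" "u \<in> S2" "v \<notin> S2" "v' * (u - v) = (u - v) * v" "conjugate_step E u B C B' C'"
    and "E * v * v - B * v + C = 0"
  defines "w \<equiv> inverse E * B - v" and "w' \<equiv> inverse E * B' - v'"
  shows "u + v' - v + w' = w + inverse E * u * E"
    and "w' * (u + v' - v) = inverse E * u * E * w"
    and "w \<notin> S2 \<longleftrightarrow> w' \<notin> S2"
proof -
  note cs = assms(5)[unfolded conjugate_step_def]
  define s t where "s = u + v' - v" and "t = inverse E * u * E"
  have "s \<in> S2" unfolding s_def by (rule baecklund_edge(1)[OF assms(2-4)])
  have Et: "E * t = u * E" using assms(1) by (simp add: t_def flip: mult.assoc)
  have Ew: "E * w = B - E * v" "E * w' = B' - E * v'"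
    using assms(1) by (simp_all add: w_def w'_def right_diff_distrib flip: mult.assoc)
  have "E * (s + w') = E * (w + t)"
    using cs by (simp add: distrib_left Ew Et) (simp add: s_def algebra_simps)
  then show sum: "u + v' - v + w' = w + inverse E * u * E"
    using assms(1) by (simp add: s_def t_def)
  have C: "C = B * v - E * v * v" using assms(6) by (simp add: algebra_simps)
  have C': "C' = B' * v' - E * v' * v'"
    using assms(6) root_step_iff[OF assms(2-5)] by (simp add: algebra_simps)
  have "E * (w' * s) = (B' * u + C') - E * (v' * (u - v)) - B' * v"
    by (simp add: Ew C' s_def algebra_simps flip: mult.assoc)
  also have "\<dots> = C + u * B - E * ((u - v) * v) - B' * v"
    using cs assms(4) by (simp add: add.commute)
  also have "\<dots> = u * B - (B' + E * u - B) * v"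
    by (simp add: C algebra_simps)
  also have "\<dots> = u * (E * w)"
    using cs by (simp add: Ew algebra_simps)
  also have "\<dots> = E * (t * w)"
    using Et by (metis mult.assoc)
  finally have prod: "w' * s = t * w" using assms(1) by simp
  then show "w' * (u + v' - v) = inverse E * u * E * w" by (simp add: s_def t_def)
  have w': "w' = w + t - s" using sum by (simp add: s_def t_def algebra_simps)
  have conj: "w' * (s - w) = (s - w) * w"
    using prod by (simp add: w' algebra_simps)
  have "t \<in> S2" using quat_conj_invariants(1)[of E u t] assms(1,2) Et by simp
  show "w \<notin> S2 \<longleftrightarrow> w' \<notin> S2"
  proof (cases "s = w")
    \<comment> \<open>Conjugation by \<open>s - w\<close> degenerates here, but \<open>w = s\<close>
      and \<open>w' = t\<close> both lie in \<open>S2\<close>.\<close>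
    case True
    then show ?thesis using \<open>s \<in> S2\<close> \<open>t \<in> S2\<close> w' by simp
  next
    case False
    then show ?thesis using quat_conj_invariants(1)[OF _ conj] by simp
  qed
qed

section \<open>The algorithm\<close>

text \<open>The conserved quantities. By cyclicity of the real part, the commutator
  \<open>u E - E u\<close> and its product \<open>- E - u E u\<close> with \<open>u\<close> have
  real part zero.\<close>

lemma algorithm_real_parts:
  assumes "u \<in> S2" "B' = B + u * E - E * u"
  shows "qRe B' = qRe B" "qRe (u * B') = qRe (B * u)"
proof -
  show "qRe B' = qRe B" using assms(2) qRe_mult_commute[of u E] by simp
  have uu: "u * u = - 1" using assms(1) by (simp add: S2_iff_mult)
  have "u * B' = u * B + (u * u) * E - u * (E * u)"
    by (simp add: assms(2) algebra_simps)
  also have "qRe \<dots> = qRe (u * B) - qRe E - qRe (u * (E * u))"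
    unfolding uu by simp
  also have "qRe (u * (E * u)) = qRe (E * (u * u))"
    using qRe_mult_commute[of u "E * u"] by (simp only: mult.assoc)
  finally show "qRe (u * B') = qRe (B * u)"
    unfolding uu using qRe_mult_commute[of u B] by simp
qed

lemma algorithm_step:
  assumes "B' \<noteq> 0" "u' = inverse B' * u * B'"
  shows "u * B' = B' * u'" "u \<in> S2 \<longleftrightarrow> u' \<in> S2"
proof -
  show "u * B' = B' * u'" using assms by (simp flip: mult.assoc)
  from quat_conj_invariants(1)[OF assms(1) this] show "u \<in> S2 \<longleftrightarrow> u' \<in> S2" .
qed

lemma algorithm_invariants:
  assumes I: "I = {0..} \<or> I = UNIV"
    and "u0 \<in> S2" and run: "algorithm_run I E B0 u0 B u" and "k \<in> I"
  shows "u k \<in> S2" "qRe (B k) = qRe B0" "qRe (B k * u k) = qRe (B0 * u0)"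
proof -
  have step: "B (i + 1) = B i + u i * E - E * u i" "B (i + 1) \<noteq> 0"
    "u (i + 1) = inverse (B (i + 1)) * u i * B (i + 1)" if "i \<in> I" for i
    using that run unfolding algorithm_run_def by blast+
  have init: "B 0 = B0" "u 0 = u0" using run by (simp_all add: algorithm_run_def)
  have S2: "u i \<in> S2" if "i \<in> I" for i
    using index_induct[OF I that, of "\<lambda>i. u i \<in> S2"] algorithm_step(2)[OF step(2,3)] init assms(2)
    by simp
  show "u k \<in> S2" using S2 \<open>k \<in> I\<close> .
  have "qRe (B (i + 1)) = qRe (B i) \<and> qRe (B (i + 1) * u (i + 1)) = qRe (B i * u i)"
    if "i \<in> I" for i
    using algorithm_real_parts[OF S2 step(1), OF that that] algorithm_step(1)[OF step(2,3), OF that that]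
    by simp
  then show "qRe (B k) = qRe B0" "qRe (B k * u k) = qRe (B0 * u0)"
    using index_induct[OF I \<open>k \<in> I\<close>, of "\<lambda>i. qRe (B i) = qRe B0"]
      index_induct[OF I \<open>k \<in> I\<close>, of "\<lambda>i. qRe (B i * u i) = qRe (B0 * u0)"] init
    by (simp_all del: quat_mult_sel)
qed

text \<open>The conserved pair stays nonzero, so \<open>B\<close> never vanishes and the steps can
  be iterated and inverted. The run found satisfies the relations at every integer.\<close>

lemma algorithm_run_exists:
  assumes "admissible_data E B0 u0"
  shows "\<exists>B u. algorithm_run I E B0 u0 B u"
proof -
  define S where "S = {(B, u). u \<in> S2 \<and> (qRe (B * u), qRe B) \<noteq> (0, 0)}"
  define R :: "int \<Rightarrow> quat \<times> quat \<Rightarrow> quat \<times> quat \<Rightarrow> bool" where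
    "R = (\<lambda>_ (B, u) (B', u'). B' = B + u * E - E * u \<and> B' \<noteq> 0 \<and> u' = inverse B' * u * B')"
  obtain f where f: "f 0 = (B0, u0)" "\<And>i. R i (f i) (f (i + 1))"
  proof (rule two_sided_recursion[of "(B0, u0)" S R])
    show "(B0, u0) \<in> S" using assms by (auto simp: S_def admissible_data_def)
  next
    fix i x assume "x \<in> S"
    then obtain B u where x: "x = (B, u)" "u \<in> S2" "(qRe (B * u), qRe B) \<noteq> (0, 0)"
      by (auto simp: S_def)
    define B' u' where "B' = B + u * E - E * u" and "u' = inverse B' * u * B'"
    note re = algorithm_real_parts[OF x(2) B'_def]
    have "B' \<noteq> 0"
    proof
      assume "B' = 0"
      then show False using re x(3) by simp
    qed
    note step = algorithm_step[OF this u'_def]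
    have "(B', u') \<in> S" using step re x by (simp add: S_def del: quat_mult_sel)
    moreover have "R i x (B', u')" using \<open>B' \<noteq> 0\<close> by (simp add: R_def x B'_def u'_def)
    ultimately show "\<exists>y\<in>S. R i x y" ..
  next
    fix i y assume "y \<in> S"
    then obtain B' u' where y: "y = (B', u')" "u' \<in> S2" "(qRe (B' * u'), qRe B') \<noteq> (0, 0)"
      by (auto simp: S_def)
    have "B' \<noteq> 0" using y(3) by auto
    define u B where "u = B' * u' * inverse B'" and "B = B' - u * E + E * u"
    have u': "u' = inverse B' * u * B'"
      using \<open>B' \<noteq> 0\<close> by (simp add: u_def mult.assoc) (simp flip: mult.assoc)
    note step = algorithm_step[OF \<open>B' \<noteq> 0\<close> u']
    have B': "B' = B + u * E - E * u" by (simp add: B_def)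
    have "u \<in> S2" using step(2) y(2) by simp
    note re = algorithm_real_parts[OF this B']
    have "(B, u) \<in> S" using step(1) re y \<open>u \<in> S2\<close> by (simp add: S_def del: quat_mult_sel)
    moreover have "R i (B, u) y" using \<open>B' \<noteq> 0\<close> u' B' by (simp add: R_def y)
    ultimately show "\<exists>x\<in>S. R i x y" ..
  qed blast
  have "algorithm_run I E B0 u0 (\<lambda>i. fst (f i)) (\<lambda>i. snd (f i))"
    using f(2) unfolding algorithm_run_def R_def split_beta f(1) fst_conv snd_conv by blast
  then show ?thesis by blast
qed

text \<open>If \<open>u' = - u\<close> then \<open>B'\<close> anticommutes with \<open>u\<close>, which kills both conserved quantities.\<close>

lemma algorithm_step_regular:
  assumes "u \<in> S2" "u * B = B * u'" "(qRe (B * u'), qRe B) \<noteq> (0, 0)"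
  shows "u + u' \<noteq> 0"
proof
  assume "u + u' = 0"
  then have u': "u' = - u" by (simp add: eq_neg_iff_add_eq_0 add.commute)
  have uu: "u * u = - 1" using assms(1) by (simp add: S2_iff_mult)
  have anti: "u * B = - (B * u)" using assms(2) u' by simp
  have "qRe (B * u) = 0" using arg_cong[OF anti, of qRe] by simp
  then have "qRe (B * u') = 0" unfolding u' by simp
  moreover have "qRe B = 0"
  proof -
    have "u * B * u = B" using anti uu by (simp add: mult.assoc)
    then have "qRe B = qRe (u * (u * B))" using qRe_mult_commute[of "u * B" u] by (simp only:)
    also have "u * (u * B) = - B" using uu by (simp flip: mult.assoc)
    finally show ?thesis by simp
  qed
  ultimately show False using assms(3) by simp
qed

text \<open>With this constant coefficient \<open>C\<close>, the quaternion
  \<open>C - E - B u\<close> is the real number \<open>r\<close>, so \<open>u\<close> is fixed by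
  the monodromy. The value of \<open>r\<close> remains free.\<close>

lemma algorithm_conjugate_step:
  assumes "u \<in> S2" "B' = B + u * E - E * u" "u * B' = B' * u'"
  shows "conjugate_step E u B (E + r *\<^sub>R 1 + B * u) B' (E + r *\<^sub>R 1 + B' * u')"
proof -
  have uu: "u * u = - 1" "u * (u * p) = - p" for p
    using assms(1) by (simp_all add: S2_iff_mult flip: mult.assoc)
  show ?thesis
    unfolding conjugate_step_def assms(3)[symmetric]
    by (simp add: assms(2) algebra_simps uu)
qed

section \<open>From a run of the algorithm to a 2-invariant curve\<close>

lemma two_invariant_algorithm:
  assumes I: "I = {0..} \<or> I = UNIV"
    and adm: "admissible_data E B0 u0" and run: "algorithm_run I E B0 u0 B u"
    and curve: "discrete_curve I \<gamma>" and edges: "\<And>i. i \<in> I \<Longrightarrow> \<gamma> (i + 1) - \<gamma> i = u i"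
  shows "two_invariant I \<gamma>"
proof -
  have "0 \<in> I" using I by auto
  have succ: "i + 1 \<in> I" if "i \<in> I" for i
    using I that by auto
  have "E \<noteq> 0" "u0 \<in> S2" and nz: "(qRe (B0 * u0), qRe B0) \<noteq> (0, 0)"
    using adm by (simp_all add: admissible_data_def)
  note inv = algorithm_invariants[OF I \<open>u0 \<in> S2\<close> run]
  have init: "B 0 = B0" "u 0 = u0" using run by (simp_all add: algorithm_run_def)
  have B_step: "B (i + 1) = B i + u i * E - E * u i"
    and Bu: "u i * B (i + 1) = B (i + 1) * u (i + 1)" if "i \<in> I" for i
    using that run algorithm_step(1) unfolding algorithm_run_def by blast+
  have edge: "edge \<gamma> k = u k" if "k \<in> I" for k
    using edges[OF that] by (simp add: edge_def)
  have nzk: "(qRe (B k * u k), qRe (B k)) \<noteq> (0, 0)" if "k \<in> I" for k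
    using inv[OF that] nz by (simp del: quat_mult_sel)
  \<comment> \<open>so large that \<open>A\<close> and \<open>B\<close> differ in norm at \<open>0\<close>, which keeps \<open>r\<close> and \<open>r1\<close> out of \<open>S2\<close>\<close>
  define t where "t = 2 * norm B0 + 1"
  define C where "C k = E + t *\<^sub>R 1 + B k * u k" for k
  have cs: "conjugate_step E (u i) (B i) (C i) (B (i + 1)) (C (i + 1))" if "i \<in> I" for i
    unfolding C_def by (rule algorithm_conjugate_step[OF inv(1) B_step Bu]) (rule that)+
  obtain r where r: "E * r * r - B0 * r + C 0 = 0"
    using quat_quadratic_root[OF \<open>E \<noteq> 0\<close>] .
  define r1 where "r1 = inverse E * B0 - r"
  have larger: "norm (C 0 - E) > norm B0"
  proof -
    have "t = norm ((C 0 - E) - B0 * u0)" by (simp add: C_def init t_def)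
    also have "\<dots> \<le> norm (C 0 - E) + norm B0"
      using norm_triangle_ineq4[of "C 0 - E" "B0 * u0"] norm_S2[OF \<open>u0 \<in> S2\<close>]
      by (simp add: norm_mult)
    finally show ?thesis using norm_ge_zero[of B0] by (simp add: t_def)
  qed
  have "r \<notin> S2"
  proof
    assume "r \<in> S2"
    then have "C 0 - E = B0 * r" using r by (simp add: S2_iff_mult mult.assoc algebra_simps)
    then show False using larger norm_S2[OF \<open>r \<in> S2\<close>] by (simp add: norm_mult)
  qed
  have Er1: "E * r1 = B0 - E * r"
    using \<open>E \<noteq> 0\<close> by (simp add: r1_def right_diff_distrib flip: mult.assoc)
  have "r1 \<notin> S2"
  proof
    assume "r1 \<in> S2"
    have B0: "B0 = E * (r1 + r)" using Er1 by (simp add: distrib_left)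
    have "C 0 = E * r1 * r" unfolding Er1 using r by (simp add: algebra_simps)
    also have "\<dots> - E = E * r1 * (r1 + r)"
      using \<open>r1 \<in> S2\<close> by (simp add: S2_iff_mult distrib_left mult.assoc)
    finally show False using larger norm_S2[OF \<open>r1 \<in> S2\<close>] by (simp add: B0 norm_mult)
  qed
  obtain v where v0: "v 0 = r" and v: "\<And>i. v i \<notin> S2"
    and "\<And>i. i \<in> I \<longrightarrow> v (i + 1) * (u i - v i) = (u i - v i) * v i"
  \<comment> \<open>Outside \<open>I\<close> nothing is known about \<open>u\<close>, so the
    relation is guarded by \<open>i \<in> I\<close>.\<close>
  proof (rule two_sided_recursion[of r "- S2" "\<lambda>i x y. i \<in> I \<longrightarrow> y * (u i - x) = (u i - x) * x"])
    show "\<exists>y\<in>- S2. i \<in> I \<longrightarrow> y * (u i - x) = (u i - x) * x" if "x \<in> - S2" for i x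
      using baecklund_edge_forward[of "u i" x] inv(1) that by blast
    show "\<exists>x\<in>- S2. i \<in> I \<longrightarrow> y * (u i - x) = (u i - x) * x" if "y \<in> - S2" for i y
      using baecklund_edge_backward[of "u i" y] inv(1) that by blast
  qed (use \<open>r \<notin> S2\<close> in auto)
  then have v_step: "v (i + 1) * (u i - v i) = (u i - v i) * v i" if "i \<in> I" for i
    using that by blast
  note bt = baecklund_edge[OF inv(1) v v_step]
  have root: "E * v k * v k - B k * v k + C k = 0" if "k \<in> I" for k
    by (rule index_induct[OF I that]) (use r v0 init root_step_iff[OF inv(1) v v_step cs] in auto)
  define w where "w k = inverse E * B k - v k" for k
  note bt2 = second_factor_step[OF \<open>E \<noteq> 0\<close> inv(1) v v_step cs root, folded w_def]
  have w: "w k \<notin> S2" if "k \<in> I" for k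
    by (rule index_induct[OF I that])
      (use bt2(3) \<open>r1 \<notin> S2\<close> in \<open>auto simp: w_def init r1_def v0\<close>)
  \<comment> \<open>The real part of \<open>v\<close> is constant along the curve, so its vector
    part alone gives the right edges and keeps \<open>\<gamma>1\<close> imaginary.\<close>
  define \<gamma>1 \<gamma>2 where "\<gamma>1 k = \<gamma> k + vec_part (v k)" and "\<gamma>2 k = inverse E * \<gamma> k * E" for k
  have edge1: "edge \<gamma>1 k = u k + v (k + 1) - v k" if "k \<in> I" for k
    using bt(4)[OF that that] edge[OF that, symmetric]
    by (simp add: edge_def \<gamma>1_def vec_part_def quat_eq_iff)
  have edge2: "edge \<gamma>2 k = inverse E * u k * E" if "k \<in> I" for k
    by (simp add: edge_def \<gamma>2_def edge[OF that, unfolded edge_def, symmetric] algebra_simps)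
  have E\<gamma>2: "\<gamma> k * E = E * \<gamma>2 k" for k
    using \<open>E \<noteq> 0\<close> by (simp add: \<gamma>2_def flip: mult.assoc)
  have curve1: "discrete_curve I \<gamma>1"
    using curve by (simp add: discrete_curve_def imaginary_def \<gamma>1_def vec_part_def)
  have curve2: "discrete_curve I \<gamma>2"
    using curve quat_conj_invariants(2)[OF \<open>E \<noteq> 0\<close> E\<gamma>2]
    by (simp add: discrete_curve_def imaginary_def)
  have "baecklund_transform I \<gamma> v \<gamma>1"
    using curve curve1 inv(1) v bt(1,2)
    by (simp add: baecklund_transform_def edge edge1)
  moreover have "baecklund_transform I \<gamma>1 w \<gamma>2"
  proof -
    have "inverse E * u k * E \<in> S2" if "k \<in> I" for k
      using quat_conj_invariants(1)[of E "u k" "inverse E * u k * E"] \<open>E \<noteq> 0\<close> inv(1)[OF that]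
      by (simp flip: mult.assoc)
    then show ?thesis
      using curve1 curve2 w bt(1) bt2(1,2)
      by (simp add: baecklund_transform_def edge1 edge2)
  qed
  moreover have "\<gamma> k = E * \<gamma>2 k * inverse E + 0" for k
    using E\<gamma>2[of k, symmetric] \<open>E \<noteq> 0\<close> by (simp add: mult.assoc)
  moreover have "\<not> acts_as_identity (monodromy E (v k) (w k))" if "k \<in> I" for k
  proof -
    have Ew: "E * w k = B k - E * v k"
      using \<open>E \<noteq> 0\<close> by (simp add: w_def right_diff_distrib flip: mult.assoc)
    have B: "monodromy E (v k) (w k) $ 1 $ 2 = B k"
      by (simp add: monodromy_entries distrib_left Ew)
    have "monodromy E (v k) (w k) $ 1 $ 1 = E * w k * v k - E"
      by (simp add: monodromy_entries algebra_simps)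
    moreover have "C k = B k * v k - E * v k * v k"
      using root[OF that] by (simp add: algebra_simps)
    ultimately have "monodromy E (v k) (w k) $ 1 $ 1 = C k - E"
      by (simp add: Ew left_diff_distrib)
    then have "monodromy E (v k) (w k) $ 1 $ 1 = t *\<^sub>R 1 + B k * u k"
      by (simp add: C_def)
    \<comment> \<open>If \<open>B k\<close> is real, the other vector part is
      \<open>qRe (B k)\<close> times the unit vector \<open>u k\<close>. Its vanishing gives
      \<open>B k = 0\<close>, against the conserved pair.\<close>
    moreover have "\<not> (vec_part (t *\<^sub>R 1 + B k * u k) = 0 \<and> vec_part (B k) = 0)"
    proof
      assume "vec_part (t *\<^sub>R 1 + B k * u k) = 0 \<and> vec_part (B k) = 0"
      then have "qI (B k) = 0" "qJ (B k) = 0" "qK (B k) = 0"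
        "qRe (B k) * qI (u k) = 0" "qRe (B k) * qJ (u k) = 0" "qRe (B k) * qK (u k) = 0"
        by (auto simp: vec_part_def quat_eq_iff)
      then show False using nzk[OF that] inv(1)[OF that] by (auto simp: S2_iff)
    qed
    ultimately show ?thesis
      using acts_as_identity_iff[OF monodromy_denominator_nonzero[OF \<open>E \<noteq> 0\<close> v w[OF that]]]
      by (simp add: B)
  qed
  moreover have "arc_length_parametrized I \<gamma>"
    using inv(1) norm_S2 by (simp add: arc_length_parametrized_def edge)
  moreover have "regular I \<gamma>"
    unfolding regular_def
  proof (intro allI impI)
    fix k assume "k - 1 \<in> I \<and> k + 1 \<in> I"
    then have k: "k - 1 \<in> I" "k \<in> I" using succ[of "k - 1"] by auto
    have "u (k - 1) + u k \<noteq> 0"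
      using algorithm_step_regular[OF inv(1)[OF k(1)] Bu[OF k(1)]] nzk[OF k(2)] by simp
    moreover have "\<gamma> (k + 1) - \<gamma> (k - 1) = u (k - 1) + u k"
      using edges[OF k(1)] edges[OF k(2)] by (simp add: algebra_simps)
    ultimately show "\<gamma> (k - 1) \<noteq> \<gamma> (k + 1)" by auto
  qed
  ultimately show ?thesis
    using curve \<open>E \<noteq> 0\<close> unfolding two_invariant_def
    by (intro conjI exI[of _ v] exI[of _ w] exI[of _ \<gamma>1] exI[of _ \<gamma>2] exI[of _ E] exI[of _ 0])
      (auto simp: imaginary_def)
qed

section \<open>Fixed points of the monodromy\<close>

text \<open>\<open>p\<close> is fixed by \<open>u \<mapsto> (A - B u) u (A - B u)\<^sup>-\<^sup>1\<close> iff \<open>A - B p\<close> commutes with \<open>p\<close>.\<close>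

definition fixed_by :: "quat \<Rightarrow> quat \<Rightarrow> quat \<Rightarrow> bool" where
  "fixed_by A B p \<longleftrightarrow> (A - B * p) * p = p * (A - B * p)"

text \<open>The centralizer of \<open>p\<close> is spanned by \<open>1\<close> and \<open>p\<close>:
  commuting means that the cross product of the vector parts vanishes.\<close>

lemma commute_S2:
  assumes "p \<in> S2" "g * p = p * g"
  shows "g = qRe g *\<^sub>R 1 - qRe (g * p) *\<^sub>R p"
proof -
  have p: "qRe p = 0" "qI p * qI p + qJ p * qJ p + qK p * qK p = 1"
    using assms(1) by (simp_all add: S2_iff power2_eq_square)
  have "qJ g * qK p = qK g * qJ p" "qK g * qI p = qI g * qK p" "qI g * qJ p = qJ g * qI p"
    using assms(2) by (simp_all add: quat_eq_iff p(1) mult.commute)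
  with p have "qI g = (qI g * qI p + qJ g * qJ p + qK g * qK p) * qI p"
    "qJ g = (qI g * qI p + qJ g * qJ p + qK g * qK p) * qJ p"
    "qK g = (qI g * qI p + qJ g * qJ p + qK g * qK p) * qK p"
    by algebra+
  with p show ?thesis by (simp add: quat_eq_iff algebra_simps)
qed

text \<open>The centralizer formula for \<open>A - B p\<close>, solved for the vector part of
  \<open>A\<close>, so that two fixed points can be compared.\<close>

lemma fixed_by_vec_part:
  assumes "p \<in> S2" "fixed_by A B p"
  shows "vec_part A = vec_part B * p - qRe (B * p) *\<^sub>R 1 - qRe (A * p) *\<^sub>R p"
proof -
  have "qRe p = 0" "p * p = - 1" using assms(1) by (simp_all add: S2_iff flip: S2_iff_mult)
  have "(A - B * p) * p = A * p + B"
    using \<open>p * p = - 1\<close> by (simp add: left_diff_distrib mult.assoc)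
  then have "A - B * p = qRe (A - B * p) *\<^sub>R 1 - qRe (A * p + B) *\<^sub>R p"
    using commute_S2[OF assms(1)] assms(2) by (metis fixed_by_def)
  moreover have vec_part: "vec_part q = q - qRe q *\<^sub>R 1" for q
    by (simp add: vec_part_def quat_eq_iff)
  ultimately show ?thesis
    unfolding vec_part by (simp add: algebra_simps \<open>qRe p = 0\<close> del: quat_mult_sel)
qed

text \<open>Equate the two expressions for \<open>a\<close>, and likewise for \<open>b\<close>,
  after multiplying by the other fixed point. The triple products cancel in the real parts, leaving
  a factor \<open>1 - c\<close>, where \<open>c\<close> is the cosine of the angle between
  \<open>x\<close> and \<open>y\<close>.\<close>

lemma two_fixed_points:
  assumes S2: "x \<in> S2" "y \<in> S2" and "x \<noteq> y" and fixed: "fixed_by A B x" "fixed_by A B y"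
  shows "qRe (A * x) = - qRe (A * y)" "qRe (B * x) = - qRe (B * y)"
    and "(vec_part B - qRe (A * y) *\<^sub>R 1) * y = - (x * (vec_part B - qRe (A * y) *\<^sub>R 1))"
    and "qRe (A * y) = 0 \<Longrightarrow> qRe (B * y) = 0 \<Longrightarrow> vec_part A = 0 \<and> vec_part B = 0"
proof -
  define a b where "a = vec_part A" and "b = vec_part B"
  define p q p' q' c where "p = qRe (B * x)" and "q = qRe (A * x)"
    and "p' = qRe (B * y)" and "q' = qRe (A * y)" and "c = - qRe (x * y)"
  have re: "qRe x = 0" "qRe y = 0" "qRe a = 0" "qRe b = 0"
    using S2 by (simp_all add: S2_iff a_def b_def vec_part_def)
  have ax: "a = b * x - p *\<^sub>R 1 - q *\<^sub>R x" and ay: "a = b * y - p' *\<^sub>R 1 - q' *\<^sub>R y"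
    using fixed_by_vec_part[OF S2(1) fixed(1)] fixed_by_vec_part[OF S2(2) fixed(2)]
    by (simp_all add: a_def b_def p_def q_def p'_def q'_def)
  have xx: "x * x = - 1" and yy: "y * y = - 1" using S2 by (simp_all add: S2_iff_mult)
  have pq: "p = qRe (b * x)" "q = qRe (a * x)" "p' = qRe (b * y)" "q' = qRe (a * y)"
    using re by (simp_all add: p_def q_def p'_def q'_def a_def b_def vec_part_def)
  have b_x: "b = - (a * x) - p *\<^sub>R x + q *\<^sub>R 1"
    by (subst ax) (simp add: left_diff_distrib mult.assoc xx)
  have b_y: "b = - (a * y) - p' *\<^sub>R y + q' *\<^sub>R 1"
    by (subst ay) (simp add: left_diff_distrib mult.assoc yy)
  have "c \<noteq> 1"
  proof
    assume "c = 1"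
    have "qnorm2 (x - y) = 2 - 2 * c"
      using S2 by (simp add: S2_iff c_def power2_eq_square algebra_simps)
    then show False using \<open>c = 1\<close> \<open>x \<noteq> y\<close> qnorm2_eq_0[of "x - y"] by simp
  qed
  have "qRe (a * y) = qRe (b * x * y) + q * c"
    by (subst ax) (simp add: c_def re algebra_simps)
  moreover have "qRe (a * x) = qRe (b * y * x) + q' * c"
    by (subst ay) (simp add: c_def re algebra_simps)
  moreover have "qRe (b * x * y) + qRe (b * y * x) = 0"
    by (simp add: re algebra_simps)
  ultimately have "(q + q') * (1 - c) = 0"
    unfolding pq(2,4)[symmetric] by algebra
  then have q: "q = - q'" using \<open>c \<noteq> 1\<close> by simp
  have "qRe (b * y) = - qRe (a * x * y) + p * c"
    by (subst b_x) (simp add: c_def re algebra_simps)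
  moreover have "qRe (b * x) = - qRe (a * y * x) + p' * c"
    by (subst b_y) (simp add: c_def re algebra_simps)
  moreover have "qRe (a * x * y) + qRe (a * y * x) = 0"
    by (simp add: re algebra_simps)
  ultimately have "(p + p') * (1 - c) = 0"
    unfolding pq(1,3)[symmetric] by algebra
  then have p: "p = - p'" using \<open>c \<noteq> 1\<close> by simp
  show "qRe (A * x) = - qRe (A * y)" "qRe (B * x) = - qRe (B * y)"
    using p q by (simp_all add: p_def q_def p'_def q'_def del: quat_mult_sel)
  \<comment> \<open>This is the quaternionic conjugate of \<open>ax\<close>; \<open>a\<close>,
    \<open>b\<close> and \<open>x\<close> are imaginary.\<close>
  have "x * b = - a + p *\<^sub>R 1 - q *\<^sub>R x"
    using ax re by (simp add: quat_eq_iff algebra_simps)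
  moreover have "b * y = a + p' *\<^sub>R 1 + q' *\<^sub>R y" using ay by (simp add: algebra_simps)
  ultimately show "(vec_part B - qRe (A * y) *\<^sub>R 1) * y = - (x * (vec_part B - qRe (A * y) *\<^sub>R 1))"
    unfolding b_def[symmetric] q'_def[symmetric]
    by (simp add: left_diff_distrib right_diff_distrib p q)
  assume "qRe (A * y) = 0" "qRe (B * y) = 0"
  then have "a = b * x" "a = b * y" using ax ay p q by (simp_all add: p'_def q'_def)
  then have "b * (x - y) = 0" by (metis diff_self right_diff_distrib)
  then have "b = 0" using \<open>x \<noteq> y\<close> by simp
  then show "vec_part A = 0 \<and> vec_part B = 0" using \<open>a = b * x\<close> by (simp add: a_def b_def)
qed

text \<open>\<open>C - E - B u\<close> is the value at \<open>- u\<close> of the polynomial, and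
  evaluating the identity there shows that it commutes with \<open>u\<close>. For
  \<open>- u\<close>, multiply the identity by \<open>\<lambda> - u\<close> on both sides and cancel
  the central \<open>\<lambda>^2 + 1\<close>.\<close>

lemma conjugate_step_fixed:
  assumes "u \<in> S2" "conjugate_step E u B C B' C'"
  shows "fixed_by (C - E) B u" "fixed_by (C' - E) B' (- u)"
    and "qRe ((C' - E) * u) = qRe ((C - E) * u)"
proof -
  have uu: "u * u = - 1" "u * (u * p) = - p" for p
    using assms(1) by (simp_all add: S2_iff_mult flip: mult.assoc)
  have B': "B' = u * E + B - E * u" and C': "C' = C + u * B - B' * u" and C'u: "C' * u = u * C"
    using assms(2) by (simp_all add: conjugate_step_def algebra_simps)
  have Cu: "C * u + u * B * u + B + u * E - E * u = u * C"
    using C'u unfolding C' B' by (simp add: algebra_simps uu)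
  then show "fixed_by (C - E) B u"
    by (simp add: fixed_by_def algebra_simps uu)
  have "u * C' = u * C - B - u * (B' * u)"
    unfolding C' by (simp add: algebra_simps uu)
  then show "fixed_by (C' - E) B' (- u)"
    using C'u by (simp add: fixed_by_def algebra_simps uu) (simp add: B' algebra_simps uu)
  show "qRe ((C' - E) * u) = qRe ((C - E) * u)"
    using C'u qRe_mult_commute[of u C] by (simp add: left_diff_distrib del: quat_mult_sel)
qed

text \<open>Compare coefficients in \<open>(w' + \<lambda>) (v' + \<lambda>) (u + \<lambda>) = (w' +
  \<lambda>) (s + \<lambda>) (v + \<lambda>) = (t + \<lambda>) (w + \<lambda>) (v +
  \<lambda>)\<close>, multiplied by \<open>E\<close> on the left.\<close>

lemma baecklund_conjugate_step:
  assumes "u + v' = v + s" "v' * u = s * v" "s + w' = w + t" "w' * s = t * w" "u * E = E * t"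
  shows "conjugate_step E u (E * (w + v)) (E * (w * v)) (E * (w' + v')) (E * (w' * v'))"
proof -
  have "w' + v' + u = (s + w') + (u + v') - s" by (simp add: algebra_simps)
  also have "\<dots> = t + (w + v)" unfolding assms(1,3) by (simp add: algebra_simps)
  finally have "w' + v' + u = t + (w + v)" .
  then have "E * (w' + v' + u) = E * t + E * (w + v)" by (simp only: distrib_left)
  moreover have "w' * v' + (w' + v') * u = w' * (u + v') + v' * u"
    by (simp add: algebra_simps)
  then have "w' * v' + (w' + v') * u = (s + w') * v + w' * s"
    unfolding assms(1,2) by (simp add: algebra_simps)
  then have "w' * v' + (w' + v') * u = w * v + t * (w + v)"
    unfolding assms(3,4) by (simp add: algebra_simps)
  then have "E * (w' * v' + (w' + v') * u) = E * (w * v) + E * t * (w + v)"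
    by (simp add: distrib_left mult.assoc)
  moreover have "w' * v' * u = t * w * v"
    using assms(2,4) by (metis mult.assoc)
  then have "E * (w' * v') * u = E * t * (w * v)" by (simp add: mult.assoc)
  ultimately show ?thesis
    unfolding conjugate_step_def assms(5)[symmetric]
    by (simp add: distrib_left distrib_right mult.assoc)
qed

section \<open>From a 2-invariant curve to a run of the algorithm\<close>

lemma algorithm_two_invariant:
  assumes I: "I = {0..} \<or> I = UNIV" and inv: "two_invariant I \<gamma>"
  shows "\<exists>E B0 u0 B u. admissible_data E B0 u0 \<and> algorithm_run I E B0 u0 B u \<and>
    (\<forall>i\<in>I. \<gamma> (i + 1) - \<gamma> i = u i)"
proof -
  have "0 \<in> I" using I by auto
  have succ: "i + 1 \<in> I" if "i \<in> I" for i
    using I that by auto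
  from inv obtain v w \<gamma>1 \<gamma>2 E c where reg: "regular I \<gamma>"
    and bt: "baecklund_transform I \<gamma> v \<gamma>1" "baecklund_transform I \<gamma>1 w \<gamma>2"
    and "E \<noteq> 0" and motion: "\<And>k. k \<in> I \<Longrightarrow> \<gamma> k = E * \<gamma>2 k * inverse E + c"
    and nid: "\<And>k. k \<in> I \<Longrightarrow> \<not> acts_as_identity (monodromy E (v k) (w k))"
    unfolding two_invariant_def by blast
  define u where "u = edge \<gamma>"
  define B C A where "B k = E * (w k + v k)" and "C k = E * (w k * v k)" and "A k = C k - E" for k
  have u: "u k \<in> S2" if "k \<in> I" for k
    using bt(1) that by (simp add: baecklund_transform_def u_def)
  have cs: "conjugate_step E (u k) (B k) (C k) (B (k + 1)) (C (k + 1))" if "k \<in> I" for k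
    unfolding B_def C_def
  proof (rule baecklund_conjugate_step)
    show "u k + v (k + 1) = v k + edge \<gamma>1 k" "v (k + 1) * u k = edge \<gamma>1 k * v k"
      using bt(1) that by (simp_all add: baecklund_transform_def u_def)
    show "edge \<gamma>1 k + w (k + 1) = w k + edge \<gamma>2 k" "w (k + 1) * edge \<gamma>1 k = edge \<gamma>2 k * w k"
      using bt(2) that by (simp_all add: baecklund_transform_def)
    have "u k = E * edge \<gamma>2 k * inverse E"
      using motion[OF that] motion[OF succ[OF that]]
      by (simp add: u_def edge_def algebra_simps)
    then show "u k * E = E * edge \<gamma>2 k" using \<open>E \<noteq> 0\<close> by (simp add: mult.assoc)
  qed
  have nz: "vec_part (A k) \<noteq> 0 \<or> vec_part (B k) \<noteq> 0" if "k \<in> I" for k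
  proof -
    have "v k \<notin> S2" "w k \<notin> S2"
      using bt that by (simp_all add: baecklund_transform_def)
    from acts_as_identity_iff[OF monodromy_denominator_nonzero[OF \<open>E \<noteq> 0\<close> this]] nid[OF that]
    show ?thesis by (simp add: monodromy_entries A_def B_def C_def right_diff_distrib)
  qed
  define Bh where "Bh k = vec_part (B k) - qRe (A k * u k) *\<^sub>R 1" for k
  have step: "Bh (k + 1) = Bh k + u k * E - E * u k" "u k * Bh (k + 1) = Bh (k + 1) * u (k + 1)"
    "(qRe (Bh (k + 1) * u (k + 1)), qRe (Bh (k + 1))) \<noteq> (0, 0)" if "k \<in> I" for k
  proof -
    note fixed = conjugate_step_fixed[OF u cs, folded A_def]
    have "\<gamma> k \<noteq> \<gamma> (k + 2)"
      using reg[unfolded regular_def, rule_format, of "k + 1"] that succ[OF succ[OF that]]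
      by (simp add: add.assoc)
    then have "- u k \<noteq> u (k + 1)"
      by (auto simp: u_def edge_def add.assoc)
    note tfp = two_fixed_points[OF _ u[OF succ[OF that]] this fixed(2)[OF that that]
        fixed(1)[OF succ succ, OF that that], folded Bh_def]
    have S2: "- u k \<in> S2" using u[OF that] by (simp add: S2_iff_mult)
    \<comment> \<open>Two sign changes cancel: one from the opposite real parts at the two fixed
      points, one from the fixed point being \<open>- u k\<close>.\<close>
    have "qRe (A (k + 1) * u (k + 1)) = qRe (A k * u k)"
      using tfp(1)[OF S2] fixed(3)[OF that that] by (simp del: quat_mult_sel)
    moreover have "vec_part (B (k + 1)) = vec_part (B k) + (u k * E - E * u k)"
    proof -
      have "B (k + 1) = B k + (u k * E - E * u k)"
        using cs[OF that] by (simp add: conjugate_step_def algebra_simps)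
      then show ?thesis by (simp add: vec_part_def quat_eq_iff)
    qed
    ultimately show "Bh (k + 1) = Bh k + u k * E - E * u k"
      by (simp add: Bh_def del: quat_mult_sel)
    show "u k * Bh (k + 1) = Bh (k + 1) * u (k + 1)" using tfp(3)[OF S2] by simp
    have "qRe (u (k + 1)) = 0" using u[OF succ[OF that]] by (simp add: S2_iff)
    then have "qRe (Bh (k + 1)) = - qRe (A (k + 1) * u (k + 1))"
      "qRe (Bh (k + 1) * u (k + 1)) = qRe (B (k + 1) * u (k + 1))"
      by (simp_all add: Bh_def vec_part_def)
    then show "(qRe (Bh (k + 1) * u (k + 1)), qRe (Bh (k + 1))) \<noteq> (0, 0)"
      using tfp(4)[OF S2] nz[OF succ[OF that]] by auto
  qed
  have Bh_nz: "Bh (k + 1) \<noteq> 0" if "k \<in> I" for k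
    using step(3)[OF that] by auto
  have "u (k + 1) = inverse (Bh (k + 1)) * u k * Bh (k + 1)" if "k \<in> I" for k
    using step(2)[OF that] Bh_nz[OF that] by (simp add: mult.assoc) (simp flip: mult.assoc)
  then have "algorithm_run I E (Bh 0) (u 0) Bh u"
    using step(1) Bh_nz by (simp add: algorithm_run_def)
  moreover have "admissible_data E (Bh 0) (u 0)"
  proof -
    \<comment> \<open>\<open>step\<close> yields this only from index \<open>1\<close> on; the
      conserved quantities carry it back to \<open>0\<close>.\<close>
    have "(qRe (Bh 0 * u 0), qRe (Bh 0)) \<noteq> (0, 0)"
      using algorithm_real_parts[OF u step(1), OF \<open>0 \<in> I\<close> \<open>0 \<in> I\<close>] step(2,3)[OF \<open>0 \<in> I\<close>]
      by (simp del: quat_mult_sel)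
    moreover from this have "Bh 0 \<noteq> 0" by auto
    ultimately show ?thesis using \<open>E \<noteq> 0\<close> u[OF \<open>0 \<in> I\<close>] by (simp add: admissible_data_def)
  qed
  ultimately show ?thesis unfolding u_def edge_def by blast
qed

theorem theorem3p8:
  fixes I :: "int set"
  assumes "I = {0..} \<or> I = UNIV"
  shows "(\<forall>E B0 u0. admissible_data E B0 u0 \<longrightarrow>
            (\<exists>B u. algorithm_run I E B0 u0 B u) \<and>
            (\<forall>B u \<gamma>. algorithm_run I E B0 u0 B u \<and> discrete_curve I \<gamma> \<and>
                      (\<forall>i\<in>I. \<gamma> (i + 1) - \<gamma> i = u i) \<longrightarrow> two_invariant I \<gamma>)) \<and>
         (\<forall>\<gamma>. two_invariant I \<gamma> \<longrightarrow>
            (\<exists>E B0 u0 B u. admissible_data E B0 u0 \<and> algorithm_run I E B0 u0 B u \<and>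
                      (\<forall>i\<in>I. \<gamma> (i + 1) - \<gamma> i = u i)))"
  using algorithm_run_exists two_invariant_algorithm[OF assms] algorithm_two_invariant[OF assms]
  by blast

end
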